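(* Let $\Phi=(G,\varphi)$ be a $\mathbb{T}$-gain graph on a connected simple graph $G$ with vertex set $\{v_1,\dots,v_n\}$, and let $<$ be a total order on $V(G)$. Then: (1) $\mathrm{nullity}(\mathcal{DL}^{\min}_{<}(\Phi))=1$ if and only if $\Phi$ is balanced; (2) $\mathrm{nullity}(\mathcal{DL}^{\min}_{<}(\Phi))=0$ if and only if $\Phi$ is unbalanced.
   Context: $\mathbb{T}=\{z\in\mathbb{C}:|z|=1\}$. A $\mathbb{T}$-gain graph $\Phi=(G,\varphi)$ assigns to each of the two orientations $\vec e_{i,j},\vec e_{j,i}$ of every edge $v_iv_j$ of $G$ a gain in $\mathbb{T}$ with $\varphi(\vec e_{j,i})=\overline{\varphi(\vec e_{i,j})}$. The gain of an oriented path or cycle is the product of the gains of its consecutive oriented edges; $\Phi$ is balanced if every cycle has gain $1$. $d(u,v)$ is the shortest-path distance in $G$. For vertices $s<t$, $\varphi^{<}_{\min}(s,t)$ is the minimum of the gains of all shortest oriented paths from $s$ to $t$, with respect to the lexicographic order on $\mathbb{C}$ ($a+ib\le c+id$ iff $a<c$, or $a=c$ and $b\le d$); $\varphi^{<}_{\min}(t,s)=\overline{\varphi^{<}_{\min}(s,t)}$ and $\varphi^{<}_{\min}(s,s)=0$. $\mathcal{D}^{\min}_{<}(\Phi)=(\varphi^{<}_{\min}(v_i,v_j)d(v_i,v_j))_{i,j}$, $\mathrm{Tr}(G)=\mathrm{diag}(\mathrm{Tr}(v_1),\dots,\mathrm{Tr}(v_n))$ with $\mathrm{Tr}(v_i)=\sum_j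 d(v_i,v_j)$, and $\mathcal{DL}^{\min}_{<}(\Phi)=\mathrm{Tr}(G)-\mathcal{D}^{\min}_{<}(\Phi)$. The nullity of a matrix is the dimension of its null space. *)

theory Defs
  imports "HOL-Analysis.Analysis" "Graph_Theory.Graph_Theory"
begin

definition lex_le :: "complex \<Rightarrow> complex \<Rightarrow> bool" where
  "lex_le z w \<longleftrightarrow> Re z < Re w \<or> (Re z = Re w \<and> Im z \<le> Im w)"

definition lex_Min :: "complex set \<Rightarrow> complex" where
  "lex_Min S = (THE z. z \<in> S \<and> (\<forall>w\<in>S. lex_le z w))"

definition nullity :: "'a::field^'n^'m \<Rightarrow> nat" where
  "nullity A = vec.dim {x. A *v x = 0}"

definition diag_mat :: "('n \<Rightarrow> 'a::zero) \<Rightarrow> 'a^'n^'n" where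
  "diag_mat f = (\<chi> i j. if i = j then f i else 0)"

text \<open>A simple graph is a finite symmetric loop-free digraph whose arcs are pairs of vertices; the
  arcs \<open>(u, w)\<close> and \<open>(w, u)\<close> are the two orientations of the edge \<open>uw\<close>, and walks are lists of
  arcs. The enumeration \<open>v_1, ..., v_n\<close> of the vertices is a bijection \<open>v\<close> from a finite index type.\<close>

context pair_graph
begin

definition vdist :: "'a \<Rightarrow> 'a \<Rightarrow> real" where
  "vdist s t = real_of_ereal (\<mu> (\<lambda>_. 1) s t)"

definition shortest_paths :: "'a \<Rightarrow> 'a \<Rightarrow> ('a \<times> 'a) awalk set" where
  "shortest_paths s t = {p. apath s p t \<and> real (length p) = vdist s t}"

definition transmission :: "'a \<Rightarrow> real" where
  "transmission s = (\<Sum>t\<in>pverts G. vdist s t)"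

definition Tr_mat :: "('n \<Rightarrow> 'a) \<Rightarrow> complex^'n^'n" where
  "Tr_mat v = diag_mat (\<lambda>i. complex_of_real (transmission (v i)))"

end

locale gain_graph = pair_graph G for G :: "'a pair_pre_digraph" +
  fixes \<phi> :: "'a \<times> 'a \<Rightarrow> complex"
  assumes gain_unit: "e \<in> parcs G \<Longrightarrow> cmod (\<phi> e) = 1"
    and gain_reverse: "(s, t) \<in> parcs G \<Longrightarrow> \<phi> (t, s) = cnj (\<phi> (s, t))"
begin

definition gain :: "('a \<times> 'a) awalk \<Rightarrow> complex" where
  "gain p = prod_list (map \<phi> p)"

text \<open>The library's \<^const>\<open>pre_digraph.cycle\<close> also admits the closed walk \<open>u, w, u\<close> along a single
  edge, which is not a cycle of the undirected graph; hence the length bound.\<close>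

definition balanced :: bool where
  "balanced \<longleftrightarrow> (\<forall>p. cycle p \<and> 3 \<le> length p \<longrightarrow> gain p = 1)"

text \<open>The strict total order on the vertices is given by the relation \<open>r\<close>.\<close>

definition gain_min :: "'a rel \<Rightarrow> 'a \<Rightarrow> 'a \<Rightarrow> complex" where
  "gain_min r s t =
     (if s = t then 0
      else if (s, t) \<in> r then lex_Min (gain ` shortest_paths s t)
      else cnj (lex_Min (gain ` shortest_paths t s)))"

definition D_min :: "'a rel \<Rightarrow> ('n \<Rightarrow> 'a) \<Rightarrow> complex^'n^'n" where
  "D_min r v = (\<chi> i j. gain_min r (v i) (v j) * complex_of_real (vdist (v i) (v j)))"

definition DL_min :: "'a rel \<Rightarrow> ('n \<Rightarrow> 'a) \<Rightarrow> complex^'n^'n" where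
  "DL_min r v = Tr_mat v - D_min r v"

end

end

theory Submission
  imports Defs
begin

text \<open>
  If \<open>DL x = 0\<close>, then the row of an entry of maximal modulus exhibits that entry as a weighted
  average of the unimodular multiples \<open>g_ij x_j\<close> of the other entries, so strict convexity of the
  disc forces \<open>x_i = g_ij x_j\<close> for all \<open>j\<close>. All entries then have maximal modulus, and the
  kernel consists exactly of the solutions of \<open>x_i = g_ij x_j\<close> for all \<open>i \<noteq> j\<close>; in particular
  its dimension is at most one. On an edge \<open>g_ij\<close> is the gain of that edge, so a nonzero solution
  is a potential for the gains, and a nowhere vanishing potential exists exactly when the graph is
  balanced. Conversely a potential determines the gain of every walk, in particular that of the
  minimal shortest paths, and therefore solves all the equations.
\<close>

section \<open>Strict convexity of the disc and the kernel of a gain Laplacian\<close>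

text \<open>Equality case of the Cauchy-Schwarz inequality: expanding the squared norm of
  \<open>x - y\<close>, both assumptions together make it nonpositive.\<close>

lemma eq_if_Re_inner_ge:
  assumes "(cmod x)\<^sup>2 \<le> Re (cnj x * y)" and "cmod y \<le> cmod x"
  shows "x = y"
proof -
  have "(cmod (x - y))\<^sup>2 = (cmod x)\<^sup>2 + (cmod y)\<^sup>2 - 2 * Re (cnj x * y)"
    by (simp only: cmod_power2) (simp add: power2_eq_square algebra_simps)
  moreover have "(cmod y)\<^sup>2 \<le> (cmod x)\<^sup>2"
    using assms(2) by (simp add: power_mono)
  ultimately have "(cmod (x - y))\<^sup>2 \<le> 0"
    using assms(1) by linarith
  then show ?thesis
    by simp
qed

text \<open>Multiply the averaged equation by \<open>cnj x\<close> and take real parts. Every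
  summand becomes nonnegative because no \<open>y j\<close> is longer than \<open>x\<close>, so a
  zero sum forces each summand to vanish.\<close>

lemma weighted_average_eq_extremal:
  fixes d :: "'i \<Rightarrow> real" and y :: "'i \<Rightarrow> complex"
  assumes "finite I" and avg: "(\<Sum>j\<in>I. of_real (d j) * (x - y j)) = 0"
    and d: "\<And>j. j \<in> I \<Longrightarrow> 0 < d j"
    and y: "\<And>j. j \<in> I \<Longrightarrow> cmod (y j) \<le> cmod x"
    and "j \<in> I"
  shows "x = y j"
proof -
  have ge: "0 \<le> d j * ((cmod x)\<^sup>2 - Re (cnj x * y j))" if "j \<in> I" for j
  proof -
    have "Re (cnj x * y j) \<le> cmod (cnj x * y j)"
      by (rule complex_Re_le_cmod)
    also have "\<dots> \<le> cmod x * cmod x"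
      using y[OF that] by (simp add: norm_mult mult_left_mono)
    finally show ?thesis
      using d[OF that] by (simp add: power2_eq_square)
  qed
  have "(\<Sum>j\<in>I. d j * ((cmod x)\<^sup>2 - Re (cnj x * y j)))
      = Re (cnj x * (\<Sum>j\<in>I. of_real (d j) * (x - y j)))"
    unfolding sum_distrib_left Re_sum
    by (intro sum.cong refl, simp only: cmod_power2)
      (simp add: power2_eq_square algebra_simps)
  also have "\<dots> = 0"
    by (simp add: avg)
  finally have "d j * ((cmod x)\<^sup>2 - Re (cnj x * y j)) = 0"
    using sum_nonneg_eq_0_iff[OF \<open>finite I\<close> ge] \<open>j \<in> I\<close> by simp
  then have "(cmod x)\<^sup>2 = Re (cnj x * y j)"
    using d[OF \<open>j \<in> I\<close>] by simp
  then show ?thesis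
    using y[OF \<open>j \<in> I\<close>] by (intro eq_if_Re_inner_ge) simp_all
qed

lemma unit_weighted_laplacian_kernel:
  fixes g :: "'n::finite \<Rightarrow> 'n \<Rightarrow> complex" and d :: "'n \<Rightarrow> 'n \<Rightarrow> real"
  assumes g: "\<And>i j. i \<noteq> j \<Longrightarrow> cmod (g i j) = 1"
    and d: "\<And>i j. i \<noteq> j \<Longrightarrow> 0 < d i j"
    and d0: "\<And>i. d i i = 0"
  shows "(diag_mat (\<lambda>i. of_real (\<Sum>j\<in>UNIV. d i j)) - (\<chi> i j. g i j * of_real (d i j))) *v x = 0
    \<longleftrightarrow> (\<forall>i j. i \<noteq> j \<longrightarrow> x $ i = g i j * x $ j)" (is "?A *v x = 0 \<longleftrightarrow> _")
proof -
  have row: "(?A *v x) $ i = (\<Sum>j\<in>UNIV - {i}. of_real (d i j) * (x $ i - g i j * x $ j))" for i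
  proof -
    have "(?A *v x) $ i = (\<Sum>j\<in>UNIV. (if i = j then of_real (\<Sum>j\<in>UNIV. d i j) * x $ j else 0))
        - (\<Sum>j\<in>UNIV. of_real (d i j) * g i j * x $ j)"
      unfolding matrix_vector_mult_def diag_mat_def sum_subtractf[symmetric]
      by (auto intro!: sum.cong simp: algebra_simps)
    also have "\<dots> = (\<Sum>j\<in>UNIV. of_real (d i j) * (x $ i - g i j * x $ j))"
      by (simp add: sum_distrib_left sum_subtractf algebra_simps)
    \<comment> \<open>The term at \<open>j = i\<close> has weight zero. It must go before the
      averaging lemma applies, since that lemma wants positive weights.\<close>
    also have "\<dots> = (\<Sum>j\<in>UNIV - {i}. of_real (d i j) * (x $ i - g i j * x $ j))"
      by (rule sum.mono_neutral_right) (auto simp: d0)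
    finally show ?thesis .
  qed
  show ?thesis
  proof
    assume "?A *v x = 0"
    then have zero: "(\<Sum>j\<in>UNIV - {i}. of_real (d i j) * (x $ i - g i j * x $ j)) = 0" for i
      using row[of i] by simp
    have solved: "x $ i = g i j * x $ j"
      if max: "\<And>k. cmod (x $ k) \<le> cmod (x $ i)" and "i \<noteq> j" for i j
    proof (rule weighted_average_eq_extremal[OF _ zero[of i]])
      show "cmod (g i k * x $ k) \<le> cmod (x $ i)" if "k \<in> UNIV - {i}" for k
        using that max[of k] g[of i k] by (simp add: norm_mult)
    qed (use that d in auto)
    obtain m where m: "\<And>k. cmod (x $ k) \<le> cmod (x $ m)"
    proof -
      have "(MAX k. cmod (x $ k)) \<in> range (\<lambda>k. cmod (x $ k))"
        by (rule Max_in) simp_all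
      then obtain m where "(MAX k. cmod (x $ k)) = cmod (x $ m)"
        by blast
      moreover have "cmod (x $ k) \<le> (MAX k. cmod (x $ k))" for k
        by (rule Max_ge) simp_all
      ultimately show thesis
        using that by metis
    qed
    have "cmod (x $ k) = cmod (x $ m)" for k
      using solved[OF m, of k] g[of m k] by (cases "m = k") (simp_all add: norm_mult)
    then show "\<forall>i j. i \<noteq> j \<longrightarrow> x $ i = g i j * x $ j"
      using solved by (metis order_refl)
  next
    assume eqs: "\<forall>i j. i \<noteq> j \<longrightarrow> x $ i = g i j * x $ j"
    have "(?A *v x) $ i = 0" for i
      unfolding row
    proof (intro sum.neutral ballI)
      fix j assume "j \<in> UNIV - {i}"
      then have "x $ i - g i j * x $ j = 0"
        using eqs[rule_format, of i j] by simp
      then show "of_real (d i j) * (x $ i - g i j * x $ j) = 0"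
        by (simp only: mult_zero_right)
    qed
    then show "?A *v x = 0"
      by (simp add: vec_eq_iff)
  qed
qed

section \<open>Nullity zero and nullity one\<close>

lemma nullity_eq_0_iff: "nullity A = 0 \<longleftrightarrow> (\<forall>x. A *v x = 0 \<longrightarrow> x = 0)"
  by (auto simp: nullity_def)

lemma nullity_eq_1:
  assumes "A *v x = 0" and "x \<noteq> 0" and "\<And>y. A *v y = 0 \<Longrightarrow> \<exists>c. y = c *s x"
  shows "nullity A = 1"
proof -
  have "{y. A *v y = 0} = vec.span {x}"
    using assms(1,3) by (auto simp: vec.span_singleton vector_scalar_commute)
  then show ?thesis
    using \<open>x \<noteq> 0\<close> by (simp add: nullity_def)
qed

section \<open>The lexicographic minimum\<close>

text \<open>\<open>lex_Min\<close> is a definite description, so it means something only after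
  unique existence: existence by induction on the finite set, uniqueness by antisymmetry.\<close>

lemma lex_Min_in:
  assumes "finite S" and "S \<noteq> {}"
  shows "lex_Min S \<in> S"
proof -
  have "\<exists>z\<in>S. \<forall>w\<in>S. lex_le z w"
    using assms
  proof (induction rule: finite_ne_induct)
    case (singleton z)
    then show ?case by (simp add: lex_le_def)
  next
    case (insert a S)
    then obtain z where z: "z \<in> S" "\<forall>w\<in>S. lex_le z w"
      by blast
    show ?case
    proof (cases "lex_le z a")
      case True
      with z show ?thesis by auto
    next
      case False
      then have "\<forall>w\<in>insert a S. lex_le a w"
        using z(2) by (force simp: lex_le_def)
      then show ?thesis by blast
    qed
  qed
  moreover have "z = w" if "lex_le z w" "lex_le w z" for z w
    using that by (auto simp: lex_le_def complex_eq_iff)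
  ultimately have "\<exists>!z. z \<in> S \<and> (\<forall>w\<in>S. lex_le z w)"
    by blast
  from theI'[OF this] show ?thesis
    by (simp add: lex_Min_def)
qed

section \<open>Distances and shortest paths\<close>

context pair_graph
begin

text \<open>A walk makes \<open>t\<close> reachable from \<open>s\<close>, so the infimum of unit
  costs is attained by a path. It is therefore finite, and \<open>real_of_ereal\<close> returns the
  length of that path.\<close>

lemma vdist_le_length: "awalk s p t \<Longrightarrow> vdist s t \<le> real (length p)"
  and shortest_paths_nonempty: "awalk s p t \<Longrightarrow> shortest_paths s t \<noteq> {}"
proof -
  assume p: "awalk s p t"
  then have "s \<rightarrow>\<^sup>*\<^bsub>with_proj G\<^esub> t"
    using reachable_awalk by blast
  then obtain q where q: "apath s q t" "\<mu> (\<lambda>_. 1) s t = awalk_cost (\<lambda>_. 1) q"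
    using min_cost_awalk[of s t "\<lambda>_. 1"] by auto
  have cost: "awalk_cost (\<lambda>_. 1) l = real (length l)" for l :: "('a \<times> 'a) list"
    by (induction l) simp_all
  have vd: "vdist s t = real (length q)"
    using q(2) by (simp add: vdist_def cost)
  then show "shortest_paths s t \<noteq> {}"
    using q(1) by (auto simp: shortest_paths_def)
  show "vdist s t \<le> real (length p)"
    using min_cost_le_walk_cost[OF p, of "\<lambda>_. 1"] q(2) vd by (simp add: cost)
qed

lemma length_rev_path: "length (rev_path p) = length p"
  by (induction p) (simp_all add: rev_path_def)

lemma finite_shortest_paths: "finite (shortest_paths s t)"
  unfolding shortest_paths_def by (rule finite_subset[OF _ apaths_finite[of s t]]) auto

lemma vdist_self: "s \<in> pverts G \<Longrightarrow> vdist s s = 0"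
proof -
  assume "s \<in> pverts G"
  then have "awalk s [] s"
    by (simp add: awalk_Nil_iff)
  \<comment> \<open>The empty walk bounds the distance above by 0; being the length of some path,
    the distance is also nonnegative.\<close>
  from vdist_le_length[OF this] shortest_paths_nonempty[OF this] show ?thesis
    by (auto simp: shortest_paths_def)
qed

lemma vdist_commute:
  assumes "awalk s p t"
  shows "vdist s t = vdist t s"
proof (rule antisym)
  \<comment> \<open>Reversing a shortest path gives one inequality. It is stated for all endpoints
    so that it also applies to the reversed walk.\<close>
  have le: "vdist t s \<le> vdist s t" if p: "awalk s p t" for s p t
  proof -
    obtain q where "q \<in> shortest_paths s t"
      using shortest_paths_nonempty[OF p] by blast
    then have "awalk t (rev_path q) s" "real (length (rev_path q)) = vdist s t"
      by (auto simp: shortest_paths_def apath_def length_rev_path)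
    then show ?thesis
      using vdist_le_length by metis
  qed
  show "vdist t s \<le> vdist s t"
    using le[OF assms] .
  show "vdist s t \<le> vdist t s"
    using le[of t "rev_path p" s] assms by simp
qed

lemma vdist_pos:
  assumes "awalk s p t" and "s \<noteq> t"
  shows "0 < vdist s t"
proof -
  obtain q where "apath s q t" "real (length q) = vdist s t"
    using shortest_paths_nonempty[OF assms(1)] by (auto simp: shortest_paths_def)
  moreover from this have "q \<noteq> []"
    using \<open>s \<noteq> t\<close> by (auto simp: apath_Nil_iff)
  ultimately show ?thesis
    by (metis length_greater_0_conv of_nat_0_less_iff)
qed

lemma shortest_paths_rev:
  "p \<in> shortest_paths s t \<Longrightarrow> rev_path p \<in> shortest_paths t s"
  using vdist_commute[of s p t]
  by (auto simp: shortest_paths_def length_rev_path dest: awalkI_apath)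

text \<open>The arc itself is a walk of length 1, and the absence of loops excludes length 0. This
  makes \<open>gain_min\<close> agree with \<phi> on arcs.\<close>

lemma shortest_paths_arc:
  assumes "(s, t) \<in> parcs G" and "p \<in> shortest_paths s t"
  shows "p = [(s, t)]"
proof -
  have "s \<noteq> t"
    using pair_no_loops[OF assms(1)] by simp
  have "awalk s [(s, t)] t"
    using assms(1) by (simp add: awalk_Cons_iff awalk_Nil_iff in_arcsD2)
  from vdist_le_length[OF this] have "length p \<le> 1" and p: "awalk s p t"
    using assms(2) by (auto simp: shortest_paths_def apath_def)
  with \<open>s \<noteq> t\<close> show ?thesis
    by (cases p) (auto simp: awalk_Cons_iff awalk_Nil_iff)
qed

end

section \<open>Gains of walks and balance\<close>

context gain_graph
begin

lemma gain_Nil [simp]: "gain [] = 1"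
  and gain_Cons [simp]: "gain (e # p) = \<phi> e * gain p"
  and gain_append [simp]: "gain (p @ q) = gain p * gain q"
  by (simp_all add: gain_def)

lemma cmod_gain: "awalk s p t \<Longrightarrow> cmod (gain p) = 1"
  by (induction p arbitrary: s) (auto simp: awalk_Cons_iff norm_mult gain_unit)

lemma gain_rev_path: "awalk s p t \<Longrightarrow> gain (rev_path p) = cnj (gain p)"
  by (induction p arbitrary: s) (auto simp: rev_path_def awalk_Cons_iff gain_reverse)

text \<open>If \<open>(s, t)\<close> is not in \<open>r\<close>, \<open>gain_min\<close> is the
  conjugate of a gain from \<open>t\<close> to \<open>s\<close>, and reversing that path turns it
  into a gain from \<open>s\<close> to \<open>t\<close>. Everything later about
  \<open>gain_min\<close> off the diagonal follows from this.\<close>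

lemma gain_min_shortest_path:
  assumes "awalk s p t" and "s \<noteq> t"
  shows "\<exists>q\<in>shortest_paths s t. gain_min r s t = gain q"
proof -
  have lex: "\<exists>q\<in>shortest_paths s t. lex_Min (gain ` shortest_paths s t) = gain q"
    if "awalk s p t" for s p t
    using lex_Min_in[of "gain ` shortest_paths s t"] finite_shortest_paths
      shortest_paths_nonempty[OF that] by auto
  show ?thesis
  proof (cases "(s, t) \<in> r")
    case True
    with lex[OF assms(1)] \<open>s \<noteq> t\<close> show ?thesis
      by (simp add: gain_min_def)
  next
    case False
    obtain q where q: "q \<in> shortest_paths t s" "lex_Min (gain ` shortest_paths t s) = gain q"
      using lex[of t "rev_path p" s] assms(1) by auto
    then have "gain (rev_path q) = cnj (gain q)"
      by (auto simp: shortest_paths_def apath_def intro!: gain_rev_path)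
    with False q \<open>s \<noteq> t\<close> show ?thesis
      by (intro bexI[OF _ shortest_paths_rev[OF q(1)]]) (simp add: gain_min_def)
  qed
qed

text \<open>Induction on length: a closed walk either is a cycle in the sense of
  \<open>cycle\<close> or splits at a repeated vertex into two shorter closed walks.\<close>

lemma gain_closed_walk:
  assumes balanced and "awalk u p u"
  shows "gain p = 1"
  using assms(2)
proof (induction p arbitrary: u rule: length_induct)
  case (1 p)
  show ?case
  proof (cases p)
    case (Cons e p')
    then have e: "e \<in> parcs G" "fst e = u" and p': "awalk (snd e) p' u"
      using 1(2) by (auto simp: awalk_Cons_iff)
    show ?thesis
    proof (cases "distinct (pawalk_verts (snd e) p')")
      case True
      then have cyc: "cycle p"
        using 1(2) Cons by (auto simp: cycle_def)
      show ?thesis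
      proof (cases "3 \<le> length p")
        case True
        with cyc \<open>balanced\<close> show ?thesis
          by (simp add: balanced_def)
      next
        case False
        \<comment> \<open>\<open>balanced\<close> says nothing about cycles shorter than 3. Length 1
          would be a loop; length 2 runs along an edge and back, with gain 1 by conjugation.\<close>
        have "p' \<noteq> []"
          using pair_no_loops[OF e(1)] e(2) p' by (auto simp: awalk_Nil_iff)
        with False Cons obtain e' where "p' = [e']"
          by (cases p') (auto simp: Suc_le_eq numeral_3_eq_3)
        with p' e have "e' = (snd e, fst e)"
          by (auto simp: awalk_Cons_iff awalk_Nil_iff prod_eq_iff)
        moreover have "\<phi> e * cnj (\<phi> e) = 1"
          using gain_unit[OF e(1)] by (simp add: complex_norm_square[symmetric])
        ultimately show ?thesis
          using Cons \<open>p' = [e']\<close> gain_reverse[of "fst e" "snd e"] e(1) by simp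
      qed
    next
      case False
      \<comment> \<open>The closed subwalk \<open>c\<close> and what remains after cutting it out
        are both shorter than \<open>p\<close>, and their gains multiply to that of
        \<open>p\<close>.\<close>
      with awalk_not_distinct_decomp[OF p'] obtain q c s w where
        "p' = q @ c @ s" "0 < length c" "awalk (snd e) q w" "awalk w c w" "awalk w s u"
        by blast
      moreover from this e have "awalk u (e # q @ s) u"
        by (auto simp: awalk_Cons_iff intro: awalk_appendI)
      ultimately have "gain c = 1" "gain (e # q @ s) = 1"
        using 1(1)[rule_format, of c w] 1(1)[rule_format, of "e # q @ s" u] Cons by simp_all
      with Cons \<open>p' = q @ c @ s\<close> show ?thesis
        by simp
    qed
  qed simp
qed

text \<open>Going along \<open>p\<close> and back along \<open>q\<close> is a closed walk, and
  reversal conjugates the unimodular gain.\<close>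

lemma gain_walk_unique:
  assumes balanced and "awalk s p t" and "awalk s q t"
  shows "gain p = gain q"
proof -
  have "awalk s (p @ rev_path q) s"
    using assms(2,3) by (intro awalk_appendI[of _ _ t]) simp_all
  then have "gain p * cnj (gain q) = 1"
    using gain_closed_walk[OF \<open>balanced\<close>, of s "p @ rev_path q"] gain_rev_path[OF assms(3)]
    by simp
  moreover have "gain q * cnj (gain q) = 1"
    using cmod_gain[OF assms(3)] by (simp add: complex_norm_square[symmetric])
  ultimately show ?thesis
    by (metis mult_cancel_right mult_zero_right zero_neq_one)
qed

section \<open>Potentials\<close>

text \<open>For nowhere vanishing \<open>f\<close> this writes each arc gain as
  \<open>f s / f t\<close>. Zeros are allowed so that every kernel vector, even 0, yields a
  potential.\<close>

definition potential :: "('a \<Rightarrow> complex) \<Rightarrow> bool" where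
  "potential f \<longleftrightarrow> (\<forall>(s, t)\<in>parcs G. f s = \<phi> (s, t) * f t)"

lemma potential_walk:
  assumes "potential f"
  shows "awalk s p t \<Longrightarrow> f s = gain p * f t"
proof (induction p arbitrary: s)
  case (Cons e p)
  then have "f s = \<phi> e * f (snd e)"
    using assms by (cases e) (auto simp: potential_def awalk_Cons_iff)
  with Cons show ?case
    by (simp add: awalk_Cons_iff)
qed (simp add: awalk_Nil_iff)

text \<open>Transport around a cycle multiplies the nonzero value at its base vertex by the gain of
  the cycle, yet returns the same value.\<close>

lemma balanced_if_potential:
  assumes "potential f" and "\<And>s. s \<in> pverts G \<Longrightarrow> f s \<noteq> 0"
  shows balanced
proof -
  have "gain p = 1" if "cycle p" for p
  proof -
    obtain u where "awalk u p u"
      using \<open>cycle p\<close> by (auto simp: cycle_def)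
    moreover from this have "u \<in> pverts G"
      by (auto simp: awalk_def)
    ultimately show ?thesis
      using potential_walk[OF assms(1), of u p u] assms(2) by simp
  qed
  then show ?thesis
    by (simp add: balanced_def)
qed

text \<open>Fix a root \<open>z\<close> and let \<open>f s\<close> be the gain of a chosen walk from
  \<open>s\<close> to \<open>z\<close>. By balance the choice does not affect the gain, so a walk
  starting with the arc \<open>(s, t)\<close> may be compared with the one chosen at
  \<open>s\<close>.\<close>

lemma potential_if_balanced:
  assumes balanced and walk: "\<And>s t. s \<in> pverts G \<Longrightarrow> t \<in> pverts G \<Longrightarrow> \<exists>p. awalk s p t"
  obtains f where "potential f" and "\<And>s. s \<in> pverts G \<Longrightarrow> f s \<noteq> 0"
proof (cases "pverts G = {}")
  case True
  then have "potential (\<lambda>_. 1)"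
    by (auto simp: potential_def dest: in_arcsD1)
  with True that show ?thesis by blast
next
  case False
  then obtain z where z: "z \<in> pverts G"
    by blast
  then have "\<forall>s\<in>pverts G. \<exists>p. awalk s p z"
    using walk by blast
  then obtain w where w: "awalk s (w s) z" if "s \<in> pverts G" for s
    by (metis bchoice)
  show ?thesis
  proof (rule that)
    show "potential (\<lambda>s. gain (w s))"
      unfolding potential_def
    proof clarify
      fix s t assume st: "(s, t) \<in> parcs G"
      then have "awalk s ((s, t) # w t) z"
        using w[OF in_arcsD2[OF st]] by (simp add: awalk_Cons_iff)
      then show "gain (w s) = \<phi> (s, t) * gain (w t)"
        using gain_walk_unique[OF \<open>balanced\<close> w[OF in_arcsD1[OF st]]] by simp
    qed
    show "gain (w s) \<noteq> 0" if "s \<in> pverts G" for s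
      using cmod_gain[OF w[OF that]] by auto
  qed
qed

section \<open>The kernel of the distance Laplacian\<close>

lemma DL_min_kernel:
  fixes v :: "'n::finite \<Rightarrow> 'a" and x :: "complex^'n"
  assumes walk: "\<And>s t. s \<in> pverts G \<Longrightarrow> t \<in> pverts G \<Longrightarrow> \<exists>p. awalk s p t"
    and v: "bij_betw v UNIV (pverts G)"
  shows "DL_min r v *v x = 0 \<longleftrightarrow> (\<forall>i j. i \<noteq> j \<longrightarrow> x $ i = gain_min r (v i) (v j) * x $ j)"
proof -
  have in_verts: "v i \<in> pverts G" for i
    using v by (auto simp: bij_betw_def)
  have neq: "v i \<noteq> v j" if "i \<noteq> j" for i j
    using v that by (auto simp: bij_betw_def dest: injD)
  \<comment> \<open>Reindexing along \<open>v\<close> shows that the diagonal entries are the row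
    sums of the distance weights, as the Laplacian lemma requires.\<close>
  have "transmission (v i) = (\<Sum>j\<in>UNIV. vdist (v i) (v j))" for i
    unfolding transmission_def by (rule sum.reindex_bij_betw[OF v, symmetric])
  then have DL: "DL_min r v = diag_mat (\<lambda>i. of_real (\<Sum>j\<in>UNIV. vdist (v i) (v j)))
      - (\<chi> i j. gain_min r (v i) (v j) * of_real (vdist (v i) (v j)))"
    by (simp add: DL_min_def Tr_mat_def D_min_def)
  show ?thesis
    unfolding DL
  proof (rule unit_weighted_laplacian_kernel)
    fix i j :: 'n assume "i \<noteq> j"
    obtain p where p: "awalk (v i) p (v j)"
      using walk in_verts by blast
    show "0 < vdist (v i) (v j)"
      using vdist_pos[OF p neq[OF \<open>i \<noteq> j\<close>]] .
    show "cmod (gain_min r (v i) (v j)) = 1"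
      using gain_min_shortest_path[OF p neq[OF \<open>i \<noteq> j\<close>], of r] cmod_gain
      by (auto simp: shortest_paths_def apath_def)
  qed (simp add: vdist_self in_verts)
qed

lemma gain_min_arc:
  assumes "(s, t) \<in> parcs G"
  shows "gain_min r s t = \<phi> (s, t)"
proof -
  have "awalk s [(s, t)] t"
    using assms by (simp add: awalk_Cons_iff awalk_Nil_iff in_arcsD2)
  then obtain q where "q \<in> shortest_paths s t" "gain_min r s t = gain q"
    using gain_min_shortest_path[of s _ t r] pair_no_loops[OF assms] by auto
  then show ?thesis
    using shortest_paths_arc[OF assms, of q] by simp
qed

text \<open>\<open>the_inv v\<close> reads a vector as a function on vertices. A potential is
  transported along the shortest path realising \<open>gain_min\<close>; conversely, the equations
  at adjacent pairs suffice.\<close>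

lemma DL_min_kernel_iff_potential:
  fixes v :: "'n::finite \<Rightarrow> 'a" and x :: "complex^'n"
  assumes walk: "\<And>s t. s \<in> pverts G \<Longrightarrow> t \<in> pverts G \<Longrightarrow> \<exists>p. awalk s p t"
    and v: "bij_betw v UNIV (pverts G)"
  shows "DL_min r v *v x = 0 \<longleftrightarrow> potential (\<lambda>s. x $ the_inv v s)"
proof -
  have inj: "inj v" and in_verts: "v i \<in> pverts G" for i
    using v by (auto simp: bij_betw_def)
  have inv: "v (the_inv v s) = s" if "s \<in> pverts G" for s
    using v that f_the_inv_into_f_bij_betw by metis
  have "potential (\<lambda>s. x $ the_inv v s) \<longleftrightarrow>
      (\<forall>i j. i \<noteq> j \<longrightarrow> x $ i = gain_min r (v i) (v j) * x $ j)"
  proof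
    assume pot: "potential (\<lambda>s. x $ the_inv v s)"
    show "\<forall>i j. i \<noteq> j \<longrightarrow> x $ i = gain_min r (v i) (v j) * x $ j"
    proof (intro allI impI)
      fix i j :: 'n assume "i \<noteq> j"
      then have "v i \<noteq> v j"
        using inj by (auto dest: injD)
      moreover obtain p where "awalk (v i) p (v j)"
        using walk[OF in_verts in_verts] by blast
      ultimately obtain q where "awalk (v i) q (v j)" "gain_min r (v i) (v j) = gain q"
        using gain_min_shortest_path[of "v i" p "v j" r]
        by (auto simp: shortest_paths_def apath_def)
      then show "x $ i = gain_min r (v i) (v j) * x $ j"
        using potential_walk[OF pot, of "v i" q "v j"] by (simp add: the_inv_f_f[OF inj])
    qed
  next
    assume eqs: "\<forall>i j. i \<noteq> j \<longrightarrow> x $ i = gain_min r (v i) (v j) * x $ j"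
    show "potential (\<lambda>s. x $ the_inv v s)"
      unfolding potential_def
    proof clarify
      fix s t assume st: "(s, t) \<in> parcs G"
      then have "the_inv v s \<noteq> the_inv v t"
        using pair_no_loops[OF st] inv in_arcsD1 in_arcsD2 by (metis fst_conv snd_conv)
      with eqs have "x $ the_inv v s = gain_min r s t * x $ the_inv v t"
        using inv in_arcsD1[OF st] in_arcsD2[OF st] by metis
      then show "x $ the_inv v s = \<phi> (s, t) * x $ the_inv v t"
        by (simp add: gain_min_arc[OF st])
    qed
  qed
  then show ?thesis
    using DL_min_kernel[OF walk v] by simp
qed

section \<open>The nullity in the balanced and unbalanced cases\<close>

lemma nullity_DL_min:
  fixes v :: "'n::finite \<Rightarrow> 'a"
  assumes walk: "\<And>s t. s \<in> pverts G \<Longrightarrow> t \<in> pverts G \<Longrightarrow> \<exists>p. awalk s p t"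
    and v: "bij_betw v UNIV (pverts G)"
  shows "nullity (DL_min r v) = (if balanced then 1 else 0)"
proof -
  note kernel = DL_min_kernel_iff_potential[OF walk v]
  have inj: "inj v" and in_verts: "v i \<in> pverts G" for i
    using v by (auto simp: bij_betw_def)
  \<comment> \<open>The factor \<open>c\<close> is the gain of a walk and is the same for all kernel
    vectors. Hence one coordinate determines a kernel vector, and a single zero makes all of it
    vanish.\<close>
  have walk_eq: "\<exists>c. cmod c = 1 \<and> (\<forall>x. DL_min r v *v x = 0 \<longrightarrow> x $ i = c * x $ j)" for i j
  proof -
    obtain p where p: "awalk (v i) p (v j)"
      using walk in_verts by blast
    have "x $ i = gain p * x $ j" if "DL_min r v *v x = 0" for x
      using potential_walk[OF _ p, of "\<lambda>s. x $ the_inv v s"] that kernel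
      by (simp add: the_inv_f_f[OF inj])
    with cmod_gain[OF p] show ?thesis by blast
  qed
  have nonzero: "x $ i \<noteq> 0" if x: "DL_min r v *v x = 0" "x \<noteq> 0" for x i
  proof
    assume "x $ i = 0"
    then have "x $ j = 0" for j
      using walk_eq[of j i] x(1) by auto
    with x(2) show False
      by (simp add: vec_eq_iff)
  qed
  show ?thesis
  proof (cases balanced)
    case True
    then obtain f where f: "potential f" "\<And>s. s \<in> pverts G \<Longrightarrow> f s \<noteq> 0"
      using potential_if_balanced walk by blast
    define x :: "complex^'n" where "x = (\<chi> i. f (v i))"
    \<comment> \<open>Agreement on vertices is enough, because arcs join vertices.\<close>
    have "x $ the_inv v s = f s" if "s \<in> pverts G" for s
      using v that f_the_inv_into_f_bij_betw[of v UNIV "pverts G"] by (simp add: x_def)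
    then have "potential (\<lambda>s. x $ the_inv v s)"
      using f(1) in_arcsD1 in_arcsD2 unfolding potential_def by fastforce
    then have x: "DL_min r v *v x = 0"
      using kernel by simp
    have "x \<noteq> 0"
      using f(2)[OF in_verts] by (auto simp: x_def vec_eq_iff)
    have "\<exists>c. y = c *s x" if y: "DL_min r v *v y = 0" for y
    proof -
      \<comment> \<open>\<open>undefined\<close> serves as an arbitrary reference index; the scalar
        is the ratio of \<open>y\<close> to \<open>x\<close> there.\<close>
      define k :: 'n where "k = undefined"
      have "y $ i = y $ k / x $ k * x $ i" for i
        using walk_eq[of i k] x y nonzero[OF x \<open>x \<noteq> 0\<close>, of k] by auto
      then show ?thesis
        unfolding vec_eq_iff vector_smult_component by blast
    qed
    with nullity_eq_1[OF x \<open>x \<noteq> 0\<close>] True show ?thesis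
      by simp
  next
    case False
    have "x = 0" if x: "DL_min r v *v x = 0" for x
    proof (rule ccontr)
      assume "x \<noteq> 0"
      then have balanced
        using balanced_if_potential[of "\<lambda>s. x $ the_inv v s"] x kernel nonzero by blast
      with False show False ..
    qed
    with False show ?thesis
      by (simp add: nullity_eq_0_iff)
  qed
qed

end

theorem theorem3p7:
  fixes G :: "'a pair_pre_digraph"
    and \<phi> :: "'a \<times> 'a \<Rightarrow> complex"
    and v :: "'n::finite \<Rightarrow> 'a"
    and r :: "'a rel"
  assumes "gain_graph G \<phi>"
    and "Digraph_Component.connected (with_proj G)"
    and "bij_betw v UNIV (pverts G)"
    and "strict_linear_order_on (pverts G) r"
  shows "(nullity (gain_graph.DL_min G \<phi> r v) = 1 \<longleftrightarrow> gain_graph.balanced G \<phi>) \<and>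
         (nullity (gain_graph.DL_min G \<phi> r v) = 0 \<longleftrightarrow> \<not> gain_graph.balanced G \<phi>)"
proof -
  interpret gain_graph G \<phi>
    by fact
  \<comment> \<open>Arcs come in both orientations, so connectedness gives directed walks between
    all vertices.\<close>
  have "strongly_connected (with_proj G)"
    using symmetric_connected_imp_strongly_connected[OF pair_sym_arcs assms(2)] .
  then have "\<exists>p. awalk s p t" if "s \<in> pverts G" "t \<in> pverts G" for s t
    using that reachable_awalk by (auto simp: strongly_connected_def)
  from nullity_DL_min[OF this assms(3), of r] show ?thesis
    by simp
qed

end
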